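(* For every integer $k\geq 2$, every $k$-graph $F$, and every edge $e\in E(F)$ we have $$M_F(n)\leq\big(\pi(F-e)+o(1)\big)\binom{n}{k},$$ that is, for every $\varepsilon>0$ there is $n_0$ such that $M_F(n)\leq(\pi(F-e)+\varepsilon)\binom{n}{k}$ for all integers $n\geq n_0$.
   Context: A $k$-graph $H$ consists of a vertex set $V(H)$ and an edge set $E(H)\subseteq V(H)^{(k)}$, where $V(H)^{(k)}$ is the set of $k$-element subsets of $V(H)$. $F-e$ denotes $(V(F),E(F)\setminus\{e\})$. A copy of $F$ in $H$ is a subhypergraph of $H$ isomorphic to $F$, and $c(F,H)$ is the number of copies. For $e\in V(H)^{(k)}$, $H\cup e=(V(H),E(H)\cup\{e\})$. The $F$-process starting with $H$ is the sequence $(H_i)_{i\geq 0}$ with $H_0=H$ and $H_{i+1}$ the $k$-graph on $V(H)$ with edge set $E(H_i)\cup\{e\in V(H)^{(k)}: c(F,H_i\cup e)>c(F,H_i)\}$. Its running time is $\tau_F(H)=\min\{t\in\mathbb{N}_{\geq0}: H_t=H_{t+1}\}$ and $M_F(n)=\max\{\tau_F(H): H \text{ a } k\text{-graph on } n \text{ vertices}\}$. The extremal number $\mathrm{ex}(n,F)$ is the maximum number of edges of an $F$-free $k$-graph on $n$ vertices, and the Turán density is $\pi(F)=\lim_{n\to\infty}\mathrm{ex}(n,F)/\binom{n}{k}$. *)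

theory Defs
  imports Complex_Main "HOL-Library.Ramsey"
begin

record 'a hypergraph =
  verts :: "'a set"
  edges :: "'a set set"

definition k_graph :: "nat \<Rightarrow> 'a hypergraph \<Rightarrow> bool" where
  "k_graph k H \<longleftrightarrow> finite (verts H) \<and> edges H \<subseteq> nsets (verts H) k"

definition add_edge :: "'a hypergraph \<Rightarrow> 'a set \<Rightarrow> 'a hypergraph" where
  "add_edge H e = \<lparr>verts = verts H, edges = insert e (edges H)\<rparr>"

definition delete_edge :: "'a hypergraph \<Rightarrow> 'a set \<Rightarrow> 'a hypergraph" where
  "delete_edge H e = \<lparr>verts = verts H, edges = edges H - {e}\<rparr>"

definition isomorphic :: "'a hypergraph \<Rightarrow> 'b hypergraph \<Rightarrow> bool" where
  "isomorphic F G \<longleftrightarrow>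
     (\<exists>f. bij_betw f (verts F) (verts G) \<and> edges G = (\<lambda>e. f ` e) ` edges F)"

text \<open>A subhypergraph has its own vertex set, so isolated vertices of the pattern
  take part in a copy. Being isomorphic to a k-graph forces every edge of a copy to
  lie inside the vertex set of the copy.\<close>

definition copies :: "'a hypergraph \<Rightarrow> 'b hypergraph \<Rightarrow> 'b hypergraph set" where
  "copies F H = {G. verts G \<subseteq> verts H \<and> edges G \<subseteq> edges H \<and> isomorphic F G}"

definition num_copies :: "'a hypergraph \<Rightarrow> 'b hypergraph \<Rightarrow> nat" where
  "num_copies F H = card (copies F H)"

definition process_step :: "nat \<Rightarrow> 'a hypergraph \<Rightarrow> 'b hypergraph \<Rightarrow> 'b hypergraph" where
  "process_step k F H =
     \<lparr>verts = verts H,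
      edges = edges H \<union>
        {e \<in> nsets (verts H) k. num_copies F (add_edge H e) > num_copies F H}\<rparr>"

definition process :: "nat \<Rightarrow> 'a hypergraph \<Rightarrow> 'b hypergraph \<Rightarrow> nat \<Rightarrow> 'b hypergraph" where
  "process k F H i = (process_step k F ^^ i) H"

definition running_time :: "nat \<Rightarrow> 'a hypergraph \<Rightarrow> 'b hypergraph \<Rightarrow> nat" where
  "running_time k F H = (LEAST t. process k F H t = process k F H (Suc t))"

text \<open>Every finite hypergraph is isomorphic to one whose vertices are natural numbers,
  so it suffices to let the host hypergraphs range over these. The set below is
  nonempty and, as a process on n vertices stabilises after at most
  \<open>n choose k\<close> steps, finite.\<close>

definition max_running_time :: "nat \<Rightarrow> 'a hypergraph \<Rightarrow> nat \<Rightarrow> nat" where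
  "max_running_time k F n =
     Max {running_time k F H |H :: nat hypergraph. k_graph k H \<and> card (verts H) = n}"

text \<open>On the natural numbers \<open>Sup\<close> is the maximum of a nonempty finite set, and
  \<open>Sup {} = 0\<close>. The empty case arises precisely when F has no edge and at most
  n vertices: then no hypergraph on n vertices is F-free.\<close>

definition ex_number :: "nat \<Rightarrow> nat \<Rightarrow> 'a hypergraph \<Rightarrow> nat" where
  "ex_number k n F =
     Sup {card (edges H) |H :: nat hypergraph.
            k_graph k H \<and> card (verts H) = n \<and> copies F H = {}}"

definition turan_density :: "nat \<Rightarrow> 'a hypergraph \<Rightarrow> real" where
  "turan_density k F = lim (\<lambda>n. real (ex_number k n F) / real (n choose k))"

end

theory Submission
  imports Defs "HOL-Library.FuncSet"
begin

text \<open>Pick one new edge in every step of the process. If there are more than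
  \<open>(\<pi>(F - e) + \<epsilon>) (n choose k)\<close> of them, then by supersaturation and
  Erdos's theorem on dense partite hypergraphs they contain a large blow-up of \<open>F - e\<close>. Consider the
  edge of this blow-up that appeared last; it plays the role of some edge \<open>e' \<noteq> e\<close>. At most three of
  the picked edges appeared in the last three steps, and the blow-up has room for a copy of \<open>F\<close>
  minus \<open>{e, e'}\<close> around this edge avoiding them, and also for a copy of \<open>F - e\<close> with the same place for \<open>e\<close>.
  Hence the process adds the edge in the role of \<open>e\<close> one step later, and the last edge itself
  another step later, which is before it was picked.\<close>

subsection \<open>Turan density and supersaturation\<close>

lemma card_nsets_superset:
  assumes "finite V" "S \<subseteq> V" "card S \<le> m"
  shows "card {M \<in> nsets V m. S \<subseteq> M} = (card V - card S) choose (m - card S)"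
proof -
  have fin: "finite S" "finite (V - S)" using assms finite_subset by auto
  have "bij_betw (\<lambda>M. M - S) {M \<in> nsets V m. S \<subseteq> M} {N. N \<subseteq> V - S \<and> card N = m - card S}"
  proof (rule bij_betwI[where g = "\<lambda>N. N \<union> S"])
    show "(\<lambda>N. N \<union> S) \<in> {N. N \<subseteq> V - S \<and> card N = m - card S} \<rightarrow> {M \<in> nsets V m. S \<subseteq> M}"
    proof
      fix N assume "N \<in> {N. N \<subseteq> V - S \<and> card N = m - card S}"
      then have N: "N \<subseteq> V - S" "card N = m - card S" by auto
      then have "finite N" using fin finite_subset by blast
      moreover have "card (N \<union> S) = m"
        using N assms(3) \<open>finite N\<close> fin by (subst card_Un_disjoint) auto
      ultimately show "N \<union> S \<in> {M \<in> nsets V m. S \<subseteq> M}"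
        using N assms fin by (auto simp: nsets_def)
    qed
  qed (use fin in \<open>auto simp: nsets_def card_Diff_subset\<close>)
  then have "card {M \<in> nsets V m. S \<subseteq> M} = card {N. N \<subseteq> V - S \<and> card N = m - card S}"
    by (rule bij_betw_same_card)
  also have "\<dots> = (card V - card S) choose (m - card S)"
    using n_subsets[OF fin(2)] card_Diff_subset[OF fin(1) assms(2)] by simp
  finally show ?thesis .
qed

text \<open>Counts pairs of an edge and an \<open>m\<close>-set containing it; every
  \<open>k\<close>-set lies in the same number of \<open>m\<close>-sets. The two averaging
  arguments, for monotone densities and for supersaturation, rest on this.\<close>

lemma sum_card_nsets_restrict:
  assumes "finite V" "E \<subseteq> nsets V k" "k \<le> m"
  shows "(\<Sum>M\<in>nsets V m. card (E \<inter> nsets M k)) = ((card V - k) choose (m - k)) * card E"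
proof -
  have finE: "finite E" using assms finite_imp_finite_nsets finite_subset by blast
  have eq: "E \<inter> nsets M k = {S \<in> E. S \<subseteq> M}" for M
    using assms(2) by (auto simp: nsets_def)
  have "card {M \<in> nsets V m. S \<subseteq> M} = (card V - k) choose (m - k)" if "S \<in> E" for S
    using that assms card_nsets_superset[of V S m] by (auto simp: nsets_def)
  then show ?thesis
    unfolding eq using finE assms(1)
    by (intro sum_multicount) (auto simp: finite_imp_finite_nsets)
qed

section \<open>Extremal numbers and convergence to the Turan density\<close>

lemma ex_number_mem:
  "ex_number k n F = 0 \<or>
   (\<exists>H :: nat hypergraph. k_graph k H \<and> card (verts H) = n \<and> copies F H = {}
      \<and> card (edges H) = ex_number k n F)"
  and ex_number_upper:
  "\<lbrakk>k_graph k (H :: nat hypergraph); card (verts H) = n; copies F H = {}\<rbrakk>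
     \<Longrightarrow> card (edges H) \<le> ex_number k n F"
proof -
  let ?A = "{card (edges H) |H :: nat hypergraph.
            k_graph k H \<and> card (verts H) = n \<and> copies F H = {}}"
  have bound: "card (edges H) \<le> n choose k"
    if "k_graph k H" "card (verts H) = n" for H :: "nat hypergraph"
  proof -
    have "finite (verts H)" "edges H \<subseteq> nsets (verts H) k" using that by (auto simp: k_graph_def)
    then show ?thesis
      using card_mono[OF finite_imp_finite_nsets[of "verts H" k], of "edges H"] that(2) by simp
  qed
  have bdd: "bdd_above ?A"
    by (rule bdd_aboveI[where M = "n choose k"]) (use bound in auto)
  then have fin: "finite ?A" by (simp add: bdd_above_nat)
  show "ex_number k n F = 0 \<or>
   (\<exists>H :: nat hypergraph. k_graph k H \<and> card (verts H) = n \<and> copies F H = {}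
      \<and> card (edges H) = ex_number k n F)"
  proof (cases "?A = {}")
    case True
    \<comment> \<open>Without any \<open>F\<close>-free host, \<open>Sup {} = 0\<close> is a default
      value that no hypergraph attains; hence the first alternative.\<close>
    then show ?thesis unfolding ex_number_def True by simp
  next
    case False
    then have "Max ?A \<in> ?A" using fin by (rule Max_in[rotated])
    moreover have "ex_number k n F = Max ?A"
      unfolding ex_number_def Sup_nat_def by (rule if_not_P[OF False])
    ultimately have "ex_number k n F \<in> ?A" by simp
    then show ?thesis by auto
  qed
  show "card (edges H) \<le> ex_number k n F"
    if "k_graph k H" "card (verts H) = n" "copies F H = {}" for H :: "nat hypergraph"
    unfolding ex_number_def by (rule cSup_upper[OF _ bdd]) (use that in auto)
qed

text \<open>The density of an extremal hypergraph on \<open>n\<close> vertices is the mean density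
  of its induced subhypergraphs on \<open>m\<close> vertices, and these are \<open>F\<close>-free
  again.\<close>

lemma ex_number_ratio_mono:
  assumes "k \<le> m" "m \<le> n"
  shows "real (ex_number k n F) / real (n choose k) \<le> real (ex_number k m F) / real (m choose k)"
  using ex_number_mem[of k n F]
proof
  assume "ex_number k n F = 0"
  then show ?thesis by simp
next
  assume "\<exists>H :: nat hypergraph. k_graph k H \<and> card (verts H) = n \<and> copies F H = {}
      \<and> card (edges H) = ex_number k n F"
  then obtain H :: "nat hypergraph" where H: "k_graph k H" "card (verts H) = n" "copies F H = {}"
    "card (edges H) = ex_number k n F" by blast
  let ?a = "(n - k) choose (m - k)"
  have V: "finite (verts H)" "edges H \<subseteq> nsets (verts H) k" using H by (auto simp: k_graph_def)
  have sub: "card (edges H \<inter> nsets M k) \<le> ex_number k m F" if "M \<in> nsets (verts H) m" for M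
  proof -
    let ?H = "\<lparr>verts = M, edges = edges H \<inter> nsets M k\<rparr>"
    have M: "M \<subseteq> verts H" "finite M" "card M = m" using that by (auto simp: nsets_def)
    have "copies F ?H \<subseteq> copies F H" using M by (auto simp: copies_def)
    then show ?thesis
      using ex_number_upper[of k ?H m F] M H(3) by (auto simp: k_graph_def)
  qed
  have "?a * ex_number k n F = (\<Sum>M\<in>nsets (verts H) m. card (edges H \<inter> nsets M k))"
    using sum_card_nsets_restrict[OF V assms(1)] H by simp
  also have "\<dots> \<le> (n choose m) * ex_number k m F"
    using sum_bounded_above[of "nsets (verts H) m", OF sub] H(2) by simp
  finally have 1: "?a * ex_number k n F \<le> (n choose m) * ex_number k m F" .
  \<comment> \<open>The extra factor \<open>m choose k\<close> lets \<open>choose_mult\<close>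
    produce \<open>?a\<close> on the right as well, so that \<open>?a\<close> cancels.\<close>
  have "?a * (ex_number k n F * (m choose k)) \<le> (n choose m) * (m choose k) * ex_number k m F"
    using mult_right_mono[OF 1, of "m choose k"] by (simp add: mult_ac)
  also have "\<dots> = ?a * (ex_number k m F * (n choose k))"
    using choose_mult[OF assms] by (simp add: mult_ac)
  finally have "ex_number k n F * (m choose k) \<le> ex_number k m F * (n choose k)"
    using assms by simp
  then have "real (ex_number k n F) * real (m choose k) \<le> real (ex_number k m F) * real (n choose k)"
    by (metis of_nat_le_iff of_nat_mult)
  moreover have "real (m choose k) > 0" "real (n choose k) > 0" using assms by auto
  ultimately show ?thesis by (simp add: field_simps)
qed

text \<open>Makes the \<open>lim\<close> in \<open>turan_density\<close> a genuine limit. For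
  \<open>n < k\<close> the ratio is 0 by division by zero, so the decreasing sequence only starts at
  \<open>k\<close>, whence the shift.\<close>

lemma ex_number_ratio_tendsto:
  "(\<lambda>n. real (ex_number k n F) / real (n choose k)) \<longlonglongrightarrow> turan_density k F"
proof -
  let ?d = "\<lambda>n. real (ex_number k n F) / real (n choose k)"
  have "decseq (\<lambda>n. ?d (n + k))"
    by (intro decseq_SucI ex_number_ratio_mono) auto
  moreover have "\<forall>n. 0 \<le> ?d (n + k)" by simp
  ultimately obtain L where "(\<lambda>n. ?d (n + k)) \<longlonglongrightarrow> L" by (rule decseq_convergent)
  then have "?d \<longlonglongrightarrow> L" by (rule LIMSEQ_offset)
  then show ?thesis unfolding turan_density_def by (simp add: limI)
qed

lemma turan_density_nonneg: "turan_density k F \<ge> 0"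
  by (rule LIMSEQ_le_const[OF ex_number_ratio_tendsto]) auto

section \<open>Embeddings and supersaturation\<close>

lemma copy_imp_embedding:
  assumes "k_graph k F" "G \<in> copies F H"
  obtains \<phi> where "\<phi> \<in> verts F \<rightarrow>\<^sub>E verts H" "inj_on \<phi> (verts F)" "\<And>f. f \<in> edges F \<Longrightarrow> \<phi> ` f \<in> edges H"
proof -
  from assms(2) obtain f where f: "bij_betw f (verts F) (verts G)" "edges G = (\<lambda>e. f ` e) ` edges F"
    and G: "verts G \<subseteq> verts H" "edges G \<subseteq> edges H"
    by (auto simp: copies_def isomorphic_def)
  \<comment> \<open>Restriction makes the map extensional, so that embeddings can be counted inside
    a finite \<open>PiE\<close>; edges lie in \<open>verts F\<close>, so their images stay the
    same.\<close>
  have *: "restrict f (verts F) ` e = f ` e" if "e \<in> edges F" for e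
    using that assms(1) by (force simp: k_graph_def nsets_def)
  show ?thesis
  proof (rule that[of "restrict f (verts F)"])
    show "restrict f (verts F) \<in> verts F \<rightarrow>\<^sub>E verts H"
      using f(1) G(1) by (auto simp: bij_betw_def)
    show "inj_on (restrict f (verts F)) (verts F)" using f(1) by (auto simp: bij_betw_def)
    show "restrict f (verts F) ` e \<in> edges H" if "e \<in> edges F" for e
      using *[OF that] f(2) G(2) that by auto
  qed
qed

text \<open>For a fixed large \<open>m\<close>, at least a share \<open>\<epsilon>/2\<close> of the
  \<open>m\<close>-subsets of \<open>V\<close> span more than \<open>ex_number k m F\<close> edges
  and so contain an embedding of \<open>F\<close>. An embedding lies in only few
  \<open>m\<close>-sets, so there are many embeddings.\<close>

lemma supersaturation:
  fixes F :: "'a hypergraph"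
  assumes F: "k_graph k F" and "\<epsilon> > 0"
  shows "\<exists>c>0. \<exists>n0. \<forall>(V :: nat set) E. finite V \<longrightarrow> n0 \<le> card V \<longrightarrow> E \<subseteq> nsets V k \<longrightarrow>
           real (card E) \<ge> (turan_density k F + \<epsilon>) * real (card V choose k) \<longrightarrow>
           c * real (card V) ^ card (verts F) \<le>
           real (card {\<phi> \<in> verts F \<rightarrow>\<^sub>E V. inj_on \<phi> (verts F) \<and> (\<forall>f\<in>edges F. \<phi> ` f \<in> E)})"
proof -
  define v where "v = card (verts F)"
  let ?p = "turan_density k F"
  have "eventually (\<lambda>m. real (ex_number k m F) / real (m choose k) < ?p + \<epsilon>/2) sequentially"
    using \<open>\<epsilon> > 0\<close> by (intro order_tendstoD(2)[OF ex_number_ratio_tendsto]) auto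
  then have "eventually (\<lambda>m. real (ex_number k m F) / real (m choose k) < ?p + \<epsilon>/2
      \<and> k \<le> m \<and> v \<le> m) sequentially"
    by (intro eventually_conj eventually_ge_at_top)
  then obtain m where m: "real (ex_number k m F) / real (m choose k) < ?p + \<epsilon>/2" "k \<le> m" "v \<le> m"
    unfolding eventually_sequentially by blast
  have mk: "real (m choose k) > 0" and mv: "real (m choose v) > 0" using m by auto
  have exm: "real (ex_number k m F) \<le> (?p + \<epsilon>/2) * real (m choose k)"
    using m(1) mk by (simp add: field_simps)
  \<comment> \<open>\<open>\<epsilon>/2\<close> is the share of rich \<open>m\<close>-sets,
    \<open>m choose v\<close> comes from counting the \<open>m\<close>-sets around an embedding, and
    \<open>v ^ v\<close> from \<open>(n/v)^v \<le> n choose v\<close>. For \<open>v = 0\<close> the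
    last factor is \<open>0 ^ 0 = 1\<close>.\<close>
  define c where "c = \<epsilon> / 2 / real (m choose v) / real v ^ v"
  have vv: "real v ^ v > 0" by (cases "v = 0") auto
  show ?thesis
  proof (intro exI[of _ c] conjI exI[of _ m] allI impI)
    show "c > 0" unfolding c_def using \<open>\<epsilon> > 0\<close> mv vv by simp
  next
    fix V :: "nat set" and E
    assume V: "finite V" "m \<le> card V" "E \<subseteq> nsets V k"
      and big: "real (card E) \<ge> (?p + \<epsilon>) * real (card V choose k)"
    define n where "n = card V"
    define X where "X = {\<phi> \<in> verts F \<rightarrow>\<^sub>E V. inj_on \<phi> (verts F) \<and> (\<forall>f\<in>edges F. \<phi> ` f \<in> E)}"
    define R where "R = {M \<in> nsets V m. card (E \<inter> nsets M k) > ex_number k m F}"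
    have finF: "finite (verts F)" using F by (simp add: k_graph_def)
    have finX: "finite X" unfolding X_def using finF V by (simp add: finite_PiE)
    have finN: "finite (nsets V m)" using V by (simp add: finite_imp_finite_nsets)
    have mn: "m \<le> n" using V n_def by simp
    let ?a = "(n - k) choose (m - k)" and ?b = "(n - v) choose (m - v)"
    have a: "real ?a > 0" and b: "real ?b > 0" using mn m by auto
    have "?a * card E = (\<Sum>M\<in>nsets V m. card (E \<inter> nsets M k))"
      using sum_card_nsets_restrict[OF V(1,3) m(2)] n_def by simp
    \<comment> \<open>A rich set is charged all its \<open>k\<close>-subsets, any other set at most
      the extremal number.\<close>
    also have "\<dots> \<le> (\<Sum>M\<in>nsets V m. (if M \<in> R then m choose k else 0) + ex_number k m F)"
    proof (rule sum_mono)
      fix M assume M: "M \<in> nsets V m"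
      have "card (E \<inter> nsets M k) \<le> card (nsets M k)"
        using M by (intro card_mono finite_imp_finite_nsets) (auto simp: nsets_def)
      also have "\<dots> = m choose k" using M by (simp add: nsets_def[of V])
      finally show "card (E \<inter> nsets M k) \<le> (if M \<in> R then m choose k else 0) + ex_number k m F"
        using M by (auto simp: R_def)
    qed
    also have "\<dots> = card R * (m choose k) + (n choose m) * ex_number k m F"
    proof -
      have "R \<subseteq> nsets V m" by (auto simp: R_def)
      then have "nsets V m \<inter> {M. M \<in> R} = R" by auto
      then show ?thesis
        using finN V by (simp add: sum.distrib n_def sum.If_cases)
    qed
    finally have "real (?a * card E) \<le> real (card R * (m choose k) + (n choose m) * ex_number k m F)"
      by (simp only: of_nat_le_iff)
    then have 1: "real ?a * real (card E) \<le> real (card R) * real (m choose k)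
        + real (n choose m) * real (ex_number k m F)" by simp
    have nm: "real (n choose m) * real (m choose k) = real (n choose k) * real ?a"
      using choose_mult[OF m(2) mn] by (metis of_nat_mult)
    \<comment> \<open>The mean density over \<open>m\<close>-sets is at least
      \<open>?p + \<epsilon>\<close>, while poor sets reach only \<open>?p + \<epsilon>/2\<close>;
      rich sets have to make up the difference.\<close>
    have "real (n choose m) * ((?p + \<epsilon>) * real (m choose k)) = real ?a * ((?p + \<epsilon>) * real (n choose k))"
      using nm by (simp add: mult_ac)
    also have "\<dots> \<le> real ?a * real (card E)"
      using big n_def by (intro mult_left_mono) auto
    also note 1
    also have "real (n choose m) * real (ex_number k m F)
        \<le> real (n choose m) * ((?p + \<epsilon>/2) * real (m choose k))"
      using exm by (intro mult_left_mono) auto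
    finally have "(\<epsilon>/2 * real (n choose m)) * real (m choose k) \<le> real (card R) * real (m choose k)"
      by (simp add: algebra_simps)
    then have R: "\<epsilon>/2 * real (n choose m) \<le> real (card R)" using mk by simp
    have "\<exists>\<phi>\<in>X. \<phi> ` verts F \<subseteq> M" if "M \<in> R" for M
    proof -
      let ?H = "\<lparr>verts = M, edges = E \<inter> nsets M k\<rparr>"
      have M: "M \<subseteq> V" "finite M" "card M = m" "card (E \<inter> nsets M k) > ex_number k m F"
        using that by (auto simp: R_def nsets_def)
      have "copies F ?H \<noteq> {}"
        using ex_number_upper[of k ?H m F] M by (auto simp: k_graph_def)
      then obtain G where "G \<in> copies F ?H" by blast
      from copy_imp_embedding[OF F this] obtain \<phi> where \<phi>: "\<phi> \<in> verts F \<rightarrow>\<^sub>E M" "inj_on \<phi> (verts F)"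
        "\<And>f. f \<in> edges F \<Longrightarrow> \<phi> ` f \<in> E \<inter> nsets M k" by auto
      then have "\<phi> \<in> X" unfolding X_def using M(1) by (auto simp: PiE_iff)
      then show ?thesis using \<phi>(1) by auto
    qed
    then have "R \<subseteq> (\<Union>\<phi>\<in>X. {M \<in> nsets V m. \<phi> ` verts F \<subseteq> M})" by (auto simp: R_def)
    then have "card R \<le> card (\<Union>\<phi>\<in>X. {M \<in> nsets V m. \<phi> ` verts F \<subseteq> M})"
      using finX finN by (intro card_mono) auto
    also have "\<dots> \<le> (\<Sum>\<phi>\<in>X. card {M \<in> nsets V m. \<phi> ` verts F \<subseteq> M})"
      by (rule card_UN_le[OF finX])
    also have "\<dots> = (\<Sum>\<phi>\<in>X. ?b)"
    proof (rule sum.cong[OF refl])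
      fix \<phi> assume "\<phi> \<in> X"
      then have "\<phi> ` verts F \<subseteq> V" "card (\<phi> ` verts F) = v"
        by (auto simp: X_def v_def card_image)
      then show "card {M \<in> nsets V m. \<phi> ` verts F \<subseteq> M} = ?b"
        using card_nsets_superset[of V "\<phi> ` verts F" m] V m n_def by simp
    qed
    finally have "card R \<le> card X * ?b" by simp
    then have "real (card R) \<le> real (card X) * real ?b" by (metis of_nat_le_iff of_nat_mult)
    with R have 2: "\<epsilon>/2 * real (n choose m) \<le> real (card X) * real ?b" by linarith
    have nv: "real (n choose m) * real (m choose v) = real (n choose v) * real ?b"
      using choose_mult[OF m(3) mn] by (metis of_nat_mult)
    have "\<epsilon>/2 * real (n choose v) * real ?b = \<epsilon>/2 * real (n choose m) * real (m choose v)"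
      using nv by (simp add: mult_ac)
    also have "\<dots> \<le> real (card X) * real ?b * real (m choose v)"
      using 2 by (rule mult_right_mono) simp
    finally have "(\<epsilon>/2 * real (n choose v)) * real ?b \<le> (real (card X) * real (m choose v)) * real ?b"
      by (simp add: mult_ac)
    then have 3: "\<epsilon>/2 * real (n choose v) \<le> real (card X) * real (m choose v)" using b by simp
    have "(real n / real v) ^ v \<le> real (n choose v)"
      using binomial_ge_n_over_k_pow_k[of v n, where 'a = real] m(3) mn by simp
    then have "\<epsilon>/2 * (real n / real v) ^ v \<le> \<epsilon>/2 * real (n choose v)"
      using \<open>\<epsilon> > 0\<close> by (intro mult_left_mono) auto
    with 3 have "\<epsilon>/2 * (real n / real v) ^ v \<le> real (card X) * real (m choose v)" by linarith
    then have "c * real n ^ v \<le> real (card X)"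
      unfolding c_def using mv vv by (simp add: field_simps power_divide)
    then show "c * real (card V) ^ card (verts F) \<le>
           real (card {\<phi> \<in> verts F \<rightarrow>\<^sub>E V. inj_on \<phi> (verts F) \<and> (\<forall>f\<in>edges F. \<phi> ` f \<in> E)})"
      unfolding n_def v_def X_def .
  qed
qed

subsection \<open>Blow-ups\<close>

text \<open>Maps from \<open>I\<close> to \<open>V\<close> are the edges of a complete partite
  hypergraph whose classes are copies of \<open>V\<close>. The induction removes a coordinate
  \<open>i\<close>: many maps on the rest have a large fibre over \<open>i\<close>, some
  \<open>s\<close>-set lies in the fibres of a positive share of them, and the induction hypothesis
  applies to these.\<close>

lemma dense_subset_of_PiE_contains_box:
  fixes I :: "'a set" and c :: real
  assumes "finite I" "c > 0"
  shows "\<exists>n0. \<forall>(V :: 'b set) T. finite V \<longrightarrow> n0 \<le> card V \<longrightarrow> T \<subseteq> (I \<rightarrow>\<^sub>E V) \<longrightarrow>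
           c * real (card V) ^ card I \<le> real (card T) \<longrightarrow>
           (\<exists>W. (\<forall>i\<in>I. W i \<subseteq> V \<and> card (W i) = s) \<and> (\<Pi>\<^sub>E i\<in>I. W i) \<subseteq> T)"
  using assms
proof (induction I arbitrary: c rule: finite_induct)
  case empty
  show ?case
  proof (intro exI[of _ 0] allI impI)
    fix V :: "'b set" and T :: "('a \<Rightarrow> 'b) set"
    assume "finite V" "0 \<le> card V" and T: "T \<subseteq> {} \<rightarrow>\<^sub>E V" "c * real (card V) ^ card {} \<le> real (card T)"
    \<comment> \<open>There is just one extensional map on the empty index set, so nonemptiness of
      \<open>T\<close> suffices.\<close>
    have "card T > 0" using T(2) empty by (auto intro: Nat.gr0I)
    then have "T \<noteq> {}" by auto
    then show "\<exists>W. (\<forall>i\<in>{}. W i \<subseteq> V \<and> card (W i) = s) \<and> Pi\<^sub>E {} W \<subseteq> T"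
      using T(1) by auto
  qed
next
  case (insert i J)
  \<comment> \<open>A share \<open>c/2\<close> of the maps on \<open>J\<close> has a large fibre,
    and each such fibre contains at least a share \<open>(c / 2 / s) ^ s\<close> of the
    \<open>n ^ s\<close> bounding the number of \<open>s\<close>-sets.\<close>
  define c' where "c' = (c/2) * (c / 2 / real s) ^ s"
  have ss: "(c / 2 / real s) ^ s > 0" using insert.prems by (cases "s = 0") auto
  then have "c' > 0" unfolding c'_def using insert.prems by simp
  from insert.IH[OF this] obtain n1 where n1: "\<forall>(V :: 'b set) T. finite V \<longrightarrow> n1 \<le> card V \<longrightarrow> T \<subseteq> (J \<rightarrow>\<^sub>E V) \<longrightarrow>
      c' * real (card V) ^ card J \<le> real (card T) \<longrightarrow>
      (\<exists>W. (\<forall>i\<in>J. W i \<subseteq> V \<and> card (W i) = s) \<and> (\<Pi>\<^sub>E i\<in>J. W i) \<subseteq> T)" ..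
  \<comment> \<open>The terms provide for the induction hypothesis, for the existence of
    \<open>s\<close>-sets, for division by \<open>n\<close>, and for fibres of size
    \<open>c/2 * n\<close> having at least \<open>s\<close> points.\<close>
  define n0 where "n0 = max (max n1 s) (max 1 (nat \<lceil>2 * real s / c\<rceil>))"
  show ?case
  proof (intro exI[of _ n0] allI impI)
    fix V :: "'b set" and T :: "('a \<Rightarrow> 'b) set"
    assume V: "finite V" "n0 \<le> card V" and T: "T \<subseteq> insert i J \<rightarrow>\<^sub>E V"
      and big: "c * real (card V) ^ card (insert i J) \<le> real (card T)"
    define n where "n = card V"
    have n: "n1 \<le> n" "s \<le> n" "1 \<le> n" "2 * real s / c \<le> real n"
      using V(2) unfolding n0_def n_def by linarith+
    then have sn: "real s \<le> c/2 * real n" using insert.prems by (simp add: field_simps)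
    define P where "P = (J \<rightarrow>\<^sub>E V)"
    define N where "N g = {x \<in> V. g(i := x) \<in> T}" for g
    have finP: "finite P" unfolding P_def using insert.hyps V by (simp add: finite_PiE)
    have cardP: "card P = n ^ card J" unfolding P_def n_def using insert.hyps by (simp add: card_PiE)
    have finN: "finite (N g)" for g unfolding N_def using V by simp
    have Nn: "card (N g) \<le> n" for g unfolding N_def n_def using V by (intro card_mono) auto
    have "T \<subseteq> (\<lambda>(g, x). g(i := x)) ` (SIGMA g:P. N g)"
    proof
      fix h assume h: "h \<in> T"
      have h': "h \<in> insert i J \<rightarrow>\<^sub>E V" using h T by auto
      have eq: "h = (h(i := undefined))(i := h i)" by simp
      have "h(i := undefined) \<in> P" "h i \<in> V"
        using h' insert.hyps by (auto simp: P_def PiE_iff extensional_def)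
      moreover have "h i \<in> N (h(i := undefined))" using h \<open>h i \<in> V\<close> by (simp add: N_def)
      ultimately show "h \<in> (\<lambda>(g, x). g(i := x)) ` (SIGMA g:P. N g)"
        using eq by (intro image_eqI[of _ _ "(h(i := undefined), h i)"]) auto
    qed
    then have "card T \<le> card (SIGMA g:P. N g)"
      using finP finN by (intro surj_card_le) auto
    also have "\<dots> = (\<Sum>g\<in>P. card (N g))" using finP finN by simp
    finally have "real (card T) \<le> (\<Sum>g\<in>P. real (card (N g)))"
      by (metis of_nat_le_iff of_nat_sum)
    with big have 1: "c * real n ^ Suc (card J) \<le> (\<Sum>g\<in>P. real (card (N g)))"
      using insert.hyps n_def by simp
    \<comment> \<open>Maps outside \<open>Q\<close> contribute at most half of the total in fact
      \<open>1\<close>, which forces \<open>Q\<close> to be large.\<close>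
    define Q where "Q = {g \<in> P. c/2 * real n \<le> real (card (N g))}"
    have "(\<Sum>g\<in>P. real (card (N g))) \<le> (\<Sum>g\<in>P. (if g \<in> Q then real n else 0) + c/2 * real n)"
    proof (rule sum_mono)
      fix g assume "g \<in> P"
      then show "real (card (N g)) \<le> (if g \<in> Q then real n else 0) + c/2 * real n"
        using Nn[of g] insert.prems by (auto simp: Q_def intro: add_increasing2)
    qed
    also have "\<dots> = real (card Q) * real n + real n ^ card J * (c/2 * real n)"
    proof -
      have "P \<inter> {g. g \<in> Q} = Q" by (auto simp: Q_def)
      then show ?thesis using finP cardP by (simp add: sum.distrib sum.If_cases)
    qed
    finally have "(c/2 * real n ^ card J) * real n \<le> real (card Q) * real n"
      using 1 by (simp add: algebra_simps)
    then have Q: "c/2 * real n ^ card J \<le> real (card Q)" using n(3) by simp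
    define SS where "SS = nsets V s"
    define G where "G S = {g \<in> P. S \<subseteq> N g}" for S
    have finSS: "finite SS" unfolding SS_def using V by (simp add: finite_imp_finite_nsets)
    have cSS: "real (card SS) \<le> real n ^ s"
      using binomial_le_pow[OF n(2)] unfolding SS_def n_def by (simp flip: of_nat_power)
    have SSpos: "SS \<noteq> {}"
    proof -
      have "card SS > 0" unfolding SS_def using n by (simp add: n_def)
      then show ?thesis by auto
    qed
    have sub: "(c/2 * real n / real s) ^ s \<le> real (card {S \<in> SS. S \<subseteq> N g})" if "g \<in> Q" for g
    proof -
      have "{S \<in> SS. S \<subseteq> N g} = nsets (N g) s"
        unfolding SS_def N_def by (auto simp: nsets_def)
      then have eq: "card {S \<in> SS. S \<subseteq> N g} = card (N g) choose s" by simp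
      have le: "c/2 * real n \<le> real (card (N g))" using that by (simp add: Q_def)
      then have sN: "s \<le> card (N g)" using sn by linarith
      have "(c/2 * real n / real s) ^ s \<le> (real (card (N g)) / real s) ^ s"
        using le insert.prems by (intro power_mono divide_right_mono) auto
      also have "\<dots> \<le> real (card (N g) choose s)" by (rule binomial_ge_n_over_k_pow_k[OF sN])
      finally show ?thesis using eq by simp
    qed
    have "c' * real n ^ card J * real n ^ s = (c/2 * real n ^ card J) * (c/2 * real n / real s) ^ s"
      unfolding c'_def by (simp add: power_mult_distrib power_divide)
    also have "\<dots> \<le> real (card Q) * (c/2 * real n / real s) ^ s"
      using Q insert.prems by (intro mult_right_mono) auto
    also have "\<dots> \<le> (\<Sum>g\<in>Q. real (card {S \<in> SS. S \<subseteq> N g}))"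
      using sum_bounded_below[of Q, OF sub] by simp
    also have "\<dots> \<le> (\<Sum>g\<in>P. real (card {S \<in> SS. S \<subseteq> N g}))"
      using finP by (intro sum_mono2) (auto simp: Q_def)
    also have "\<dots> = real (\<Sum>g\<in>P. card {S \<in> SS. S \<subseteq> N g})" by simp
    also have "(\<Sum>g\<in>P. card {S \<in> SS. S \<subseteq> N g}) = (\<Sum>S\<in>SS. card (G S))"
      unfolding G_def by (rule sum_multicount_gen) (use finP finSS in auto)
    finally have tot: "c' * real n ^ card J * real n ^ s \<le> (\<Sum>S\<in>SS. real (card (G S)))" by simp
    \<comment> \<open>Pigeonhole over at most \<open>n ^ s\<close> sets \<open>S\<close>; the strict
      inequality of sums uses that \<open>SS\<close> is nonempty.\<close>
    have "\<exists>S\<in>SS. c' * real n ^ card J \<le> real (card (G S))"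
    proof (rule ccontr)
      assume "\<not> ?thesis"
      then have "(\<Sum>S\<in>SS. real (card (G S))) < (\<Sum>S\<in>SS. c' * real n ^ card J)"
        using finSS SSpos by (intro sum_strict_mono) auto
      also have "\<dots> = real (card SS) * (c' * real n ^ card J)" by simp
      also have "\<dots> \<le> real n ^ s * (c' * real n ^ card J)"
        using cSS \<open>c' > 0\<close> by (intro mult_right_mono) auto
      finally show False using tot by (simp add: mult_ac)
    qed
    then obtain S where S: "S \<in> SS" "c' * real n ^ card J \<le> real (card (G S))" by blast
    have "G S \<subseteq> J \<rightarrow>\<^sub>E V" by (auto simp: G_def P_def)
    with n1 V(1) n(1) S(2) obtain W where
      W: "\<forall>j\<in>J. W j \<subseteq> V \<and> card (W j) = s" "(\<Pi>\<^sub>E j\<in>J. W j) \<subseteq> G S"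
      unfolding n_def by meson
    show "\<exists>W. (\<forall>i\<in>insert i J. W i \<subseteq> V \<and> card (W i) = s) \<and> Pi\<^sub>E (insert i J) W \<subseteq> T"
    proof (intro exI[of _ "W(i := S)"] conjI)
      show "\<forall>j\<in>insert i J. (W(i := S)) j \<subseteq> V \<and> card ((W(i := S)) j) = s"
        using W(1) S(1) by (auto simp: SS_def nsets_def)
      show "Pi\<^sub>E (insert i J) (W(i := S)) \<subseteq> T"
      proof
        fix h assume h: "h \<in> Pi\<^sub>E (insert i J) (W(i := S))"
        have "h(i := undefined) \<in> Pi\<^sub>E J W"
          using h insert.hyps by (auto simp: PiE_iff extensional_def split: if_splits)
        then have "h(i := undefined) \<in> G S" using W(2) by blast
        moreover have "h i \<in> S" using h by (auto simp: PiE_iff)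
        ultimately have "h i \<in> N (h(i := undefined))" by (auto simp: G_def)
        then show "h \<in> T" by (simp add: N_def)
      qed
    qed
  qed
qed

text \<open>The box lemma is applied to the set of embeddings of \<open>F\<close>. As every choice
  of one vertex per class is an embedding, the classes are disjoint when \<open>s > 0\<close>, and
  all edges of the blow-up lie in \<open>E\<close>.\<close>

lemma turan_density_blowup:
  fixes F :: "'a hypergraph"
  assumes F: "k_graph k F" and "\<epsilon> > 0"
  shows "\<exists>n0. \<forall>(V :: nat set) E. finite V \<longrightarrow> n0 \<le> card V \<longrightarrow> E \<subseteq> nsets V k \<longrightarrow>
           real (card E) \<ge> (turan_density k F + \<epsilon>) * real (card V choose k) \<longrightarrow>
           (\<exists>W. (\<forall>i\<in>verts F. W i \<subseteq> V \<and> card (W i) = s) \<and>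
             (\<forall>\<phi>\<in>(\<Pi>\<^sub>E i\<in>verts F. W i). inj_on \<phi> (verts F) \<and> (\<forall>f\<in>edges F. \<phi> ` f \<in> E)))"
proof -
  have fin: "finite (verts F)" using F by (simp add: k_graph_def)
  obtain c n1 where c: "c > 0" and n1: "\<And>(V :: nat set) E. \<lbrakk>finite V; n1 \<le> card V; E \<subseteq> nsets V k;
       real (card E) \<ge> (turan_density k F + \<epsilon>) * real (card V choose k)\<rbrakk> \<Longrightarrow>
           c * real (card V) ^ card (verts F) \<le>
           real (card {\<phi> \<in> verts F \<rightarrow>\<^sub>E V. inj_on \<phi> (verts F) \<and> (\<forall>f\<in>edges F. \<phi> ` f \<in> E)})"
    using supersaturation[OF F \<open>\<epsilon> > 0\<close>] by blast
  from dense_subset_of_PiE_contains_box[OF fin c, where 'b = nat and s = s]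
  obtain n2 where n2: "\<forall>(V :: nat set) T. finite V \<longrightarrow> n2 \<le> card V \<longrightarrow> T \<subseteq> (verts F \<rightarrow>\<^sub>E V) \<longrightarrow>
      c * real (card V) ^ card (verts F) \<le> real (card T) \<longrightarrow>
      (\<exists>W. (\<forall>i\<in>verts F. W i \<subseteq> V \<and> card (W i) = s) \<and> (\<Pi>\<^sub>E i\<in>verts F. W i) \<subseteq> T)" ..
  show ?thesis
  proof (intro exI[of _ "max n1 n2"] allI impI)
    fix V :: "nat set" and E
    assume V: "finite V" "max n1 n2 \<le> card V" "E \<subseteq> nsets V k"
      "real (card E) \<ge> (turan_density k F + \<epsilon>) * real (card V choose k)"
    let ?X = "{\<phi> \<in> verts F \<rightarrow>\<^sub>E V. inj_on \<phi> (verts F) \<and> (\<forall>f\<in>edges F. \<phi> ` f \<in> E)}"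
    have "?X \<subseteq> verts F \<rightarrow>\<^sub>E V" by blast
    moreover have "c * real (card V) ^ card (verts F) \<le> real (card ?X)"
      using V by (intro n1) auto
    ultimately obtain W where W: "\<forall>i\<in>verts F. W i \<subseteq> V \<and> card (W i) = s" "(\<Pi>\<^sub>E i\<in>verts F. W i) \<subseteq> ?X"
      using n2[rule_format, of V ?X] V(1,2) by auto
    show "\<exists>W. (\<forall>i\<in>verts F. W i \<subseteq> V \<and> card (W i) = s) \<and>
             (\<forall>\<phi>\<in>(\<Pi>\<^sub>E i\<in>verts F. W i). inj_on \<phi> (verts F) \<and> (\<forall>f\<in>edges F. \<phi> ` f \<in> E))"
      by (rule exI[of _ W]) (use W in blast)
  qed
qed

subsection \<open>The F-process\<close>

lemma process_Suc: "process k F H (Suc i) = process_step k F (process k F H i)"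
  by (simp add: process_def)

lemma verts_process [simp]: "verts (process k F H i) = verts H"
  by (induction i) (simp_all add: process_Suc, simp_all add: process_def process_step_def)

lemma edges_process_mono: "i \<le> j \<Longrightarrow> edges (process k F H i) \<subseteq> edges (process k F H j)"
  by (rule lift_Suc_mono_le[where f = "\<lambda>i. edges (process k F H i)"])
     (auto simp: process_Suc process_step_def)

lemma k_graph_process: "k_graph k H \<Longrightarrow> k_graph k (process k F H i)"
  by (induction i) (simp_all add: process_Suc, simp_all add: process_def process_step_def k_graph_def)

lemma finite_copies:
  fixes F :: "'a hypergraph" and H :: "'b hypergraph"
  assumes "k_graph k H"
  shows "finite (copies F H)"
proof (rule finite_subset)
  show "copies F H \<subseteq> (\<lambda>(A, B). \<lparr>verts = A, edges = B\<rparr>) ` (Pow (verts H) \<times> Pow (edges H))"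
  proof
    fix G :: "'b hypergraph" assume "G \<in> copies F H"
    then show "G \<in> (\<lambda>(A, B). \<lparr>verts = A, edges = B\<rparr>) ` (Pow (verts H) \<times> Pow (edges H))"
      by (intro image_eqI[of _ _ "(verts G, edges G)"]) (auto simp: copies_def)
  qed
  have "finite (verts H)" "finite (edges H)"
    using assms finite_imp_finite_nsets finite_subset by (auto simp: k_graph_def)
  then show "finite ((\<lambda>(A, B). \<lparr>verts = A, edges = B\<rparr>) ` (Pow (verts H) \<times> Pow (edges H)))"
    by simp
qed

lemma image_mem_nsets:
  "\<lbrakk>f \<in> nsets A k; inj_on \<phi> A; \<phi> \<in> A \<rightarrow> B\<rbrakk> \<Longrightarrow> \<phi> ` f \<in> nsets B k"
  by (auto simp: nsets_def inj_on_subset card_image)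

lemma process_step_closes_copy:
  assumes F: "k_graph k F" and H: "k_graph k H"
    and \<phi>: "inj_on \<phi> (verts F)" "\<phi> \<in> verts F \<rightarrow> verts H"
    and f: "f \<in> edges F" "\<And>g. g \<in> edges F - {f} \<Longrightarrow> \<phi> ` g \<in> edges H"
  shows "\<phi> ` f \<in> edges (process_step k F H)"
proof (cases "\<phi> ` f \<in> edges H")
  case True
  then show ?thesis by (simp add: process_step_def)
next
  case False
  have mem: "\<phi> ` f \<in> nsets (verts H) k"
    using F f(1) image_mem_nsets[OF _ \<phi>] by (auto simp: k_graph_def)
  let ?G = "\<lparr>verts = \<phi> ` verts F, edges = (\<lambda>g. \<phi> ` g) ` edges F\<rparr>"
  have iso: "isomorphic F ?G"
    unfolding isomorphic_def using \<phi>(1) by (intro exI[of _ \<phi>]) (simp add: inj_on_imp_bij_betw)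
  have "?G \<in> copies F (add_edge H (\<phi> ` f))"
    using iso \<phi>(2) f(2) by (auto simp: copies_def add_edge_def)
  moreover have "?G \<notin> copies F H" using False f(1) by (auto simp: copies_def)
  moreover have "copies F H \<subseteq> copies F (add_edge H (\<phi> ` f))"
    by (auto simp: copies_def add_edge_def)
  moreover have "finite (copies F (add_edge H (\<phi> ` f)))"
    using H mem by (intro finite_copies[of k]) (auto simp: k_graph_def add_edge_def)
  ultimately have "num_copies F H < num_copies F (add_edge H (\<phi> ` f))"
    unfolding num_copies_def by (intro psubset_card_mono) auto
  then show ?thesis using mem by (simp add: process_step_def)
qed

section \<open>New edges and bounds on the running time\<close>

lemma obtain_new_edges:
  fixes F :: "'a hypergraph" and H :: "'b hypergraph"
  assumes "k_graph k H"
  obtains g where "\<And>t. t < running_time k F H \<Longrightarrow> g t \<in> edges (process k F H (Suc t))"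
    and "\<And>t. t < running_time k F H \<Longrightarrow> g t \<notin> edges (process k F H t)"
    and "inj_on g {..<running_time k F H}"
proof -
  let ?P = "process k F H"
  \<comment> \<open>Since the running time is the least stable index, each earlier step changes the
    hypergraph; the vertex set is fixed, so an edge is added.\<close>
  have "\<exists>f. f \<in> edges (?P (Suc t)) \<and> f \<notin> edges (?P t)" if "t < running_time k F H" for t
  proof (rule ccontr)
    assume "\<not> ?thesis"
    then have "edges (?P (Suc t)) = edges (?P t)"
      using edges_process_mono[of t "Suc t" k F H] by auto
    then have "?P t = ?P (Suc t)" by simp
    moreover have "?P t \<noteq> ?P (Suc t)"
      using that unfolding running_time_def by (rule not_less_Least)
    ultimately show False by contradiction
  qed
  then obtain g where g: "\<And>t. t < running_time k F H \<Longrightarrow> g t \<in> edges (?P (Suc t)) \<and> g t \<notin> edges (?P t)"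
    by metis
  have "g s \<noteq> g t" if "s < t" "t < running_time k F H" for s t
    using g[of s] g[of t] that edges_process_mono[of "Suc s" t k F H] by auto
  then have "inj_on g {..<running_time k F H}"
    by (intro linorder_inj_onI) auto
  with g that show ?thesis by blast
qed

text \<open>Each step before stabilisation uses up a different \<open>k\<close>-set. This keeps the
  set in \<open>max_running_time\<close> finite, so that its \<open>Max\<close> is attained.\<close>

lemma running_time_le:
  assumes "k_graph k H"
  shows "running_time k F H \<le> card (verts H) choose k"
proof -
  obtain g where g: "\<And>t. t < running_time k F H \<Longrightarrow> g t \<in> edges (process k F H (Suc t))"
    "inj_on g {..<running_time k F H}"
    using obtain_new_edges[OF assms, of F] by metis
  have "g ` {..<running_time k F H} \<subseteq> nsets (verts H) k"
    using g(1) k_graph_process[OF assms] by (fastforce simp: k_graph_def)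
  moreover have "finite (nsets (verts H) k)"
    using assms by (simp add: k_graph_def finite_imp_finite_nsets)
  ultimately have "card {..<running_time k F H} \<le> card (nsets (verts H) k)"
    using g(2) by (metis card_inj_on_le)
  then show ?thesis by simp
qed

lemma max_running_time_mem:
  "\<exists>H :: nat hypergraph. k_graph k H \<and> card (verts H) = n \<and> max_running_time k F n = running_time k F H"
proof -
  let ?A = "{running_time k F H |H :: nat hypergraph. k_graph k H \<and> card (verts H) = n}"
  have "?A \<subseteq> {..n choose k}" using running_time_le by auto
  then have "finite ?A" by (rule finite_subset) simp
  moreover have "k_graph k \<lparr>verts = {..<n}, edges = {}\<rparr>" by (simp add: k_graph_def)
  then have "?A \<noteq> {}" by (force intro: exI[of _ "\<lparr>verts = {..<n}, edges = {}\<rparr>"])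
  ultimately have "Max ?A \<in> ?A" by (rule Max_in)
  then show ?thesis unfolding max_running_time_def by blast
qed

text \<open>Any \<open>k\<close>-set can play the role of \<open>e\<close>, and the host has room
  for the remaining vertices of \<open>F\<close>. So all \<open>k\<close>-sets are present after one
  step.\<close>

lemma running_time_single_edge:
  fixes H :: "'b hypergraph"
  assumes F: "k_graph k F" "edges F = {e}" and H: "k_graph k H" "card (verts F) \<le> card (verts H)"
  shows "running_time k F H \<le> 1"
proof (rule ccontr)
  assume "\<not> ?thesis"
  then have rt: "1 < running_time k F H" by simp
  obtain g where g: "\<And>t. t < running_time k F H \<Longrightarrow> g t \<in> edges (process k F H (Suc t))"
    "\<And>t. t < running_time k F H \<Longrightarrow> g t \<notin> edges (process k F H t)"
    using obtain_new_edges[OF H(1), of F] by metis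
  have "g 1 \<in> nsets (verts H) k"
    using g(1)[OF rt] k_graph_process[OF H(1), of F "Suc 1"] by (auto simp: k_graph_def)
  then have g1: "g 1 \<subseteq> verts H" "finite (g 1)" "card (g 1) = k" by (auto simp: nsets_def)
  have e: "e \<subseteq> verts F" "finite e" "card e = k" and finF: "finite (verts F)"
    using F by (auto simp: k_graph_def nsets_def)
  have finH: "finite (verts H)" using H by (simp add: k_graph_def)
  obtain p where p: "bij_betw p e (g 1)" using e g1 finite_same_card_bij[of e "g 1"] by auto
  have "card (verts F - e) \<le> card (verts H - g 1)"
    using e g1 H(2) by (simp add: card_Diff_subset)
  then obtain q where q: "q ` (verts F - e) \<subseteq> verts H - g 1" "inj_on q (verts F - e)"
    using finF finH card_le_inj[of "verts F - e" "verts H - g 1"] by auto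
  \<comment> \<open>Glues a bijection from \<open>e\<close> onto \<open>g 1\<close> to an injection
    of the other vertices into the complement, so \<open>g 1\<close> already appears in the first
    step.\<close>
  define \<phi> where "\<phi> x = (if x \<in> e then p x else q x)" for x
  have img: "\<phi> ` e = g 1" using p by (auto simp: \<phi>_def bij_betw_def)
  have "inj_on \<phi> e" "inj_on \<phi> (verts F - e)"
    using p q(2) by (simp_all add: \<phi>_def bij_betw_def inj_on_def)
  moreover have "\<phi> ` (verts F - e) \<inter> g 1 = {}" using q(1) by (auto simp: \<phi>_def)
  ultimately have "inj_on \<phi> (e \<union> (verts F - e))"
    unfolding inj_on_Un using img by blast
  then have "inj_on \<phi> (verts F)" using e(1) by (simp add: Un_absorb1)
  moreover have "\<phi> \<in> verts F \<rightarrow> verts H"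
  proof
    fix x assume "x \<in> verts F"
    then have "\<phi> x \<in> g 1 \<or> \<phi> x \<in> verts H - g 1" using img q(1) by (cases "x \<in> e") (auto simp: \<phi>_def)
    then show "\<phi> x \<in> verts H" using g1(1) by blast
  qed
  ultimately have "\<phi> ` e \<in> edges (process_step k F H)"
    using F H by (intro process_step_closes_copy) auto
  then show False using g(2)[OF rt] img process_Suc[of k F H 0] by (simp add: process_def)
qed

section \<open>Excluding a blow-up made of new edges\<close>

lemma new_edges_no_blowup:
  fixes F :: "'a hypergraph" and H :: "'b hypergraph"
  assumes F: "k_graph k F" and e: "e \<in> edges F" and F': "edges F - {e} \<noteq> {}"
    and H: "k_graph k H"
    and g: "\<And>t. t < \<tau> \<Longrightarrow> g t \<in> edges (process k F H (Suc t))"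
      "\<And>t. t < \<tau> \<Longrightarrow> g t \<notin> edges (process k F H t)"
    and W: "\<And>i. i \<in> verts F \<Longrightarrow> W i \<subseteq> verts H" "\<And>i. i \<in> verts F \<Longrightarrow> 3 * k < card (W i)"
    and inj: "\<And>\<phi>. \<phi> \<in> (\<Pi>\<^sub>E i\<in>verts F. W i) \<Longrightarrow> inj_on \<phi> (verts F)"
    and new: "\<And>\<phi> f. \<phi> \<in> (\<Pi>\<^sub>E i\<in>verts F. W i) \<Longrightarrow> f \<in> edges F - {e} \<Longrightarrow> \<phi> ` f \<in> g ` {..<\<tau>}"
  shows False
proof -
  define B where "B = (\<Pi>\<^sub>E i\<in>verts F. W i)"
  let ?P = "\<lambda>t. edges (process k F H t)"
  have FE: "f \<subseteq> verts F" "finite f" "card f = k" if "f \<in> edges F" for f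
    using that F by (auto simp: k_graph_def nsets_def)
  \<comment> \<open>Distinct edges have the same size \<open>k\<close>, so neither contains the
    other.\<close>
  have other: "\<exists>j\<in>f. j \<notin> f'" if "f \<in> edges F" "f' \<in> edges F" "f \<noteq> f'" for f f'
    using card_subset_eq[of f' f] FE[OF that(1)] FE[OF that(2)] that(3) by auto
  \<comment> \<open>The steps whose picked edge belongs to the blow-up; \<open>t0\<close> is the
    last of them.\<close>
  define times where "times = {t. t < \<tau> \<and> (\<exists>\<phi>\<in>B. \<exists>f\<in>edges F - {e}. g t = \<phi> ` f)}"
  define t0 where "t0 = Max times"
  have fin: "finite times" unfolding times_def by simp
  have "B \<noteq> {}" unfolding B_def using W(2) by (fastforce simp: PiE_eq_empty_iff)
  then obtain \<phi> f where "\<phi> \<in> B" "f \<in> edges F - {e}" using F' by blast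
  moreover from this obtain t where "t < \<tau>" "g t = \<phi> ` f"
    using new[of \<phi> f] unfolding B_def by auto
  ultimately have "t \<in> times" unfolding times_def by blast
  then have "times \<noteq> {}" by blast
  then have "t0 \<in> times" unfolding t0_def using fin by (rule Max_in[rotated])
  then obtain \<phi>0 e' where t0: "t0 < \<tau>" and \<phi>0: "\<phi>0 \<in> B" and e': "e' \<in> edges F" "e' \<noteq> e"
    and gt0: "g t0 = \<phi>0 ` e'" unfolding times_def by auto
  \<comment> \<open>Three edges cover at most \<open>3 * k\<close> vertices, fewer than any class
    has. Truncated subtraction for \<open>t0 < 2\<close> only repeats \<open>g 0\<close>.\<close>
  define U where "U = g t0 \<union> g (t0 - 1) \<union> g (t0 - 2)"
  have late: "finite (g t)" "card (g t) = k" if "t \<le> t0" for t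
    using g(1)[of t] that t0 k_graph_process[OF H, of F "Suc t"] by (auto simp: k_graph_def nsets_def)
  have finU: "finite U" unfolding U_def using late by auto
  have "card U \<le> card (g t0) + card (g (t0 - 1)) + card (g (t0 - 2))"
    unfolding U_def by (meson card_Un_le le_trans add_le_mono1)
  then have cardU: "card U \<le> 3 * k" using late by simp
  have "\<exists>x. x \<in> W i - U" if "i \<in> verts F" for i
    using W(2)[OF that] cardU card_mono[OF finU, of "W i"] by fastforce
  then obtain z where z: "\<And>i. i \<in> verts F \<Longrightarrow> z i \<in> W i" "\<And>i. i \<in> verts F \<Longrightarrow> z i \<notin> U"
    by (metis Diff_iff)
  \<comment> \<open>A blow-up edge through a vertex \<open>z j\<close> outside \<open>U\<close> is
    none of these three edges and was picked no later than \<open>t0\<close>. Hence it was picked at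
    some \<open>t\<close> with \<open>t + 3 \<le> t0\<close> and is present at stage
    \<open>t0 - 2\<close>.\<close>
  have early: "t0 \<ge> 2 \<and> \<phi> ` f \<in> ?P (t0 - 2)"
    if as: "\<phi> \<in> B" "f \<in> edges F - {e}" "j \<in> f" "\<phi> j = z j" for \<phi> f j
  proof -
    obtain t where t: "t < \<tau>" "\<phi> ` f = g t"
      using new[of \<phi> f] as(1,2) unfolding B_def by auto
    have "t \<in> times" unfolding times_def using t(1) t(2)[symmetric] as(1,2) by blast
    then have "t \<le> t0" unfolding t0_def using fin by (rule Max_ge[rotated])
    have "z j \<in> g t" "z j \<notin> U" using t(2) as(2-4) z(2)[of j] FE[of f] by force+
    then have "t \<noteq> t0" "t \<noteq> t0 - 1" "t \<noteq> t0 - 2" unfolding U_def by auto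
    with \<open>t \<le> t0\<close> have "t0 \<ge> 2" "Suc t \<le> t0 - 2" by linarith+
    then show ?thesis using g(1)[OF t(1)] t(2) edges_process_mono[of "Suc t" "t0 - 2" k F H] by auto
  qed
  \<comment> \<open>Three steps separate the edges avoiding \<open>U\<close> from \<open>g t0\<close>, exactly the room needed
    to add first the edge in the role of \<open>e\<close>, then \<open>g t0\<close> in the role of \<open>e'\<close>.\<close>
  have closes: "\<phi> ` f \<in> ?P (Suc t)"
    if "\<phi> \<in> B" "f \<in> edges F" "\<And>f'. f' \<in> edges F - {f} \<Longrightarrow> \<phi> ` f' \<in> ?P t" for \<phi> f t
  proof -
    have "\<phi> \<in> verts F \<rightarrow> verts H" using that(1) W(1) by (force simp: B_def PiE_iff)
    then show ?thesis
      unfolding process_Suc using that inj[of \<phi>] k_graph_process[OF H]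
      by (intro process_step_closes_copy[OF F]) (auto simp: B_def)
  qed
  \<comment> \<open>\<open>x\<close> places \<open>e'\<close> on \<open>g t0\<close> and
    \<open>y\<close> places \<open>e\<close> where \<open>x\<close> does; all other vertices avoid
    \<open>U\<close>. Thus edges other than \<open>e\<close> and \<open>e'\<close> under
    \<open>x\<close>, and edges other than \<open>e\<close> under \<open>y\<close>, meet
    \<open>z\<close> and are early.\<close>
  define x where "x = (\<lambda>i\<in>verts F. if i \<in> e' then \<phi>0 i else z i)"
  define y where "y = (\<lambda>i\<in>verts F. if i \<in> e then x i else z i)"
  have xB: "x \<in> B" using z(1) \<phi>0 by (auto simp: x_def B_def PiE_iff)
  have yB: "y \<in> B" using z(1) xB by (auto simp: y_def B_def PiE_iff)
  have y: "t0 \<ge> 2 \<and> y ` f \<in> ?P (t0 - 2)" if f: "f \<in> edges F - {e}" for f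
  proof -
    obtain j where "j \<in> f" "j \<notin> e" using other[of f e] f e by auto
    moreover from this have "y j = z j" using FE f by (auto simp: y_def)
    ultimately show ?thesis using early[OF yB f] by blast
  qed
  have "t0 \<ge> 2" using y e' by blast
  have "y ` e = x ` e" using FE[OF e] by (force simp: y_def)
  then have xe: "x ` e \<in> ?P (Suc (t0 - 2))" using closes[OF yB e] y by auto
  have "x ` e' \<in> ?P (Suc (Suc (t0 - 2)))"
  proof (rule closes[OF xB e'(1)])
    fix f assume f: "f \<in> edges F - {e'}"
    show "x ` f \<in> ?P (Suc (t0 - 2))"
    proof (cases "f = e")
      case True
      then show ?thesis using xe by simp
    next
      case False
      obtain j where "j \<in> f" "j \<notin> e'" using other[of f e'] f e' by auto
      moreover from this have "x j = z j" using FE f by (auto simp: x_def)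
      ultimately have "x ` f \<in> ?P (t0 - 2)" using early[OF xB, of f j] f False by blast
      then show ?thesis using edges_process_mono[of "t0 - 2" "Suc (t0 - 2)" k F H] by auto
    qed
  qed
  moreover have "x ` e' = g t0" using FE[OF e'(1)] gt0 by (force simp: x_def)
  \<comment> \<open>So \<open>g t0\<close> is present at stage \<open>t0\<close>, although it was
    chosen as absent there.\<close>
  moreover have "Suc (Suc (t0 - 2)) = t0" using \<open>t0 \<ge> 2\<close> by simp
  ultimately show False using g(2)[OF t0] by simp
qed

section \<open>The asymptotic bound on the maximum running time\<close>

theorem theorem1p4:
  fixes k :: nat and F :: "'a hypergraph" and e :: "'a set"
  assumes "k \<ge> 2" and "k_graph k F" and "e \<in> edges F"
  shows "\<forall>\<epsilon>::real. \<epsilon> > 0 \<longrightarrow>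
    (\<exists>n\<^sub>0. \<forall>n\<ge>n\<^sub>0.
       real (max_running_time k F n)
         \<le> (turan_density k (delete_edge F e) + \<epsilon>) * real (n choose k))"
proof (intro allI impI)
  fix \<epsilon> :: real assume "\<epsilon> > 0"
  let ?F = "delete_edge F e"
  have vF: "verts ?F = verts F" and eF: "edges ?F = edges F - {e}" by (auto simp: delete_edge_def)
  have F': "k_graph k ?F" using assms(2) by (auto simp: k_graph_def vF eF)
  show "\<exists>n\<^sub>0. \<forall>n\<ge>n\<^sub>0. real (max_running_time k F n)
         \<le> (turan_density k ?F + \<epsilon>) * real (n choose k)"
  \<comment> \<open>If \<open>e\<close> is the only edge, the blow-up of \<open>F - e\<close> has no
    edges and hence no last one; this case is settled directly.\<close>
  proof (cases "edges F - {e} = {}")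
    case True
    then have single: "edges F = {e}" using assms(3) by auto
    show ?thesis
    \<comment> \<open>The first bound makes room for \<open>F\<close>; the others give
      \<open>\<epsilon> * (n choose k) \<ge> \<epsilon> * n / k^k \<ge> 1\<close>.\<close>
    proof (intro exI[of _ "max (card (verts F)) (max k (nat \<lceil>real k ^ k / \<epsilon>\<rceil>))"] allI impI)
      fix n assume n: "max (card (verts F)) (max k (nat \<lceil>real k ^ k / \<epsilon>\<rceil>)) \<le> n"
      obtain H :: "nat hypergraph" where "k_graph k H" "card (verts H) = n"
        "max_running_time k F n = running_time k F H" using max_running_time_mem by blast
      then have "max_running_time k F n \<le> 1"
        using running_time_single_edge[OF assms(2) single, of H] n by simp
      moreover have "1 \<le> \<epsilon> * real (n choose k)"
      proof -
        have "real k ^ k / \<epsilon> \<le> real n" using n by linarith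
        then have "real k ^ k \<le> \<epsilon> * real n" using \<open>\<epsilon> > 0\<close> by (simp add: field_simps)
        also have "\<dots> \<le> \<epsilon> * real n ^ k"
          using \<open>\<epsilon> > 0\<close> assms(1) n by (intro mult_left_mono self_le_power) auto
        finally have "1 \<le> \<epsilon> * (real n / real k) ^ k"
          using assms(1) by (simp add: power_divide field_simps)
        also have "\<dots> \<le> \<epsilon> * real (n choose k)"
          using \<open>\<epsilon> > 0\<close> n binomial_ge_n_over_k_pow_k[of k n, where 'a = real]
          by (intro mult_left_mono) auto
        finally show ?thesis .
      qed
      moreover have "turan_density k ?F * real (n choose k) \<ge> 0"
        using turan_density_nonneg[of k ?F] by simp
      ultimately show "real (max_running_time k F n)
         \<le> (turan_density k ?F + \<epsilon>) * real (n choose k)"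
        unfolding distrib_right by linarith
    qed
  next
    case False
    from turan_density_blowup[OF F' \<open>\<epsilon> > 0\<close>, where s = "Suc (3 * k)"]
    obtain n0 where n0: "\<forall>(V :: nat set) E. finite V \<longrightarrow> n0 \<le> card V \<longrightarrow> E \<subseteq> nsets V k \<longrightarrow>
           real (card E) \<ge> (turan_density k ?F + \<epsilon>) * real (card V choose k) \<longrightarrow>
           (\<exists>W. (\<forall>i\<in>verts ?F. W i \<subseteq> V \<and> card (W i) = Suc (3 * k)) \<and>
             (\<forall>\<phi>\<in>(\<Pi>\<^sub>E i\<in>verts ?F. W i). inj_on \<phi> (verts ?F) \<and> (\<forall>f\<in>edges ?F. \<phi> ` f \<in> E)))" ..
    show ?thesis
    proof (intro exI[of _ n0] allI impI)
      fix n assume n: "n0 \<le> n"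
      obtain H :: "nat hypergraph" where H: "k_graph k H" "card (verts H) = n"
        and max: "max_running_time k F n = running_time k F H" using max_running_time_mem by blast
      define \<tau> where "\<tau> = running_time k F H"
      obtain g where g: "\<And>t. t < \<tau> \<Longrightarrow> g t \<in> edges (process k F H (Suc t))"
        "\<And>t. t < \<tau> \<Longrightarrow> g t \<notin> edges (process k F H t)" "inj_on g {..<\<tau>}"
        using obtain_new_edges[OF H(1), of F] unfolding \<tau>_def by metis
      show "real (max_running_time k F n) \<le> (turan_density k ?F + \<epsilon>) * real (n choose k)"
      proof (rule ccontr)
        \<comment> \<open>The picked edges are as many as the steps, so a longer process makes them
          dense enough to contain the blow-up.\<close>
        assume "\<not> ?thesis"
        then have "real (card (g ` {..<\<tau>})) \<ge> (turan_density k ?F + \<epsilon>) * real (card (verts H) choose k)"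
          using g(3) max H(2) by (simp add: card_image \<tau>_def)
        moreover have "g ` {..<\<tau>} \<subseteq> nsets (verts H) k"
          using g(1) k_graph_process[OF H(1)] by (fastforce simp: k_graph_def)
        moreover have "finite (verts H)" using H(1) by (simp add: k_graph_def)
        ultimately obtain W where "\<forall>i\<in>verts F. W i \<subseteq> verts H \<and> card (W i) = Suc (3 * k)"
          "\<forall>\<phi>\<in>(\<Pi>\<^sub>E i\<in>verts F. W i). inj_on \<phi> (verts F) \<and> (\<forall>f\<in>edges F - {e}. \<phi> ` f \<in> g ` {..<\<tau>})"
          using n0[rule_format, of "verts H" "g ` {..<\<tau>}"] n H(2) unfolding vF eF by blast
        then show False
          by (intro new_edges_no_blowup[OF assms(2,3) False H(1) g(1,2), of \<tau> W]) auto
      qed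
    qed
  qed
qed

end
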